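(* Let $(\Delta_{m-1},C)$ be a spectral duality structure satisfying the vertex condition (V) with sign $\varepsilon\in\{\pm1\}$ (see context). Then: (i) at every neutral site $z_0$, $C(e_{z_0},\gamma)=C^\ast$ for all $\gamma\in(0,1)$ (this part does not require (V)); (ii) at every site $z$ of an orbit $O$, the map $\gamma\mapsto C(e_z,\gamma)$ is strictly monotone on $(0,1)$, with $\operatorname{sgn}\partial_\gamma C(e_z,\gamma)=\varepsilon\cdot\operatorname{sgn}[\mathbf d_O]_z$ for all $\gamma\in(0,1)$; (iii) the two members of each orbit respond in opposite directions: $\operatorname{sgn}\partial_\gamma C(e_z,\gamma)=-\operatorname{sgn}\partial_\gamma C(e_{\sigma(z)},\gamma)$ for all $\gamma\in(0,1)$, so that one of the functions $C(e_z,\cdot)$, $C(e_{\sigma(z)},\cdot)$ is strictly increasing and the other strictly decreasing, and $\sigma$ exchanges the class of increasing sites with the class of decreasing sites.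
   Context: Let $m\ge2$ and let $Z=\{z_1,\dots,z_m\}$ be a set of $m$ distinct sites; coordinates of $\mathbb R^m$ are indexed by $Z$, and $e_z$ is the standard basis vector (a vertex of the simplex). $\Delta_{m-1}=\{\pi\in\mathbb R^m:\pi_z\ge0,\ \sum_z\pi_z=1\}$, with relative interior $\Delta_{m-1}^\circ$. A spectral duality structure is a pair $(\Delta_{m-1},C)$, with $C:\Delta_{m-1}\times(0,1)\to\mathbb R$ smooth, admitting a spectral representation, i.e. data such that: (S1) for each $\gamma\in(0,1)$, $\pi\mapsto C(\pi,\gamma)$ is $\mathcal C^1$ on $\Delta^\circ_{m-1}$ and extends continuously to the boundary; (S2) $C(\pi,\gamma)=\sum_z\pi_zu(z;\gamma)/\sum_z\pi_zs(z;\gamma)$ with denominator strictly positive on $\Delta_{m-1}\times(0,1)$, where $u(z;\gamma)=\sum_{\nu=1}^Nf_\nu(\gamma)A_\nu(z)$, $s(z;\gamma)=\sum_{\nu=1}^Nf_\nu(\gamma)(A_\nu(z)+B_\nu(z))$, the $f_\nu$ are real-analytic and linearly independent on $(0,1)$, and the matrix $(A_\nu(z_i))\in\mathbb R^{N\times m}$ has full column rank $m\le N$; (S3) there are an involution $\sigma$ of $Z$ with at least one non-trivial pair, and weights $\kappa(z)>0$ independent of $\nu$, with $B_\nu(z)=\kappa(z)A_\nu(\sigma(z))$ for all $\nu,z$; (S4) there is $K>0$ with $\kappa(z)\kappa(\sigma(z))=K$ for all $z$. Put $C^\ast=1/(1+\sqrt K)$. An orbit is a pair $O=\{z,\sigma(z)\}$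 with $\sigma(z)\neq z$; a neutral site is a fixed point of $\sigma$. In each orbit a representative $z_O$ is fixed; the orbit director $\mathbf d_O\in\mathbb R^m$ has component $\sqrt{\kappa(z_O)}$ at $z_O$, $-\sqrt{\kappa(\sigma(z_O))}$ at $\sigma(z_O)$, and $0$ elsewhere. With $[\mathbf n_\nu]_z=(1-C^\ast)A_\nu(z)-C^\ast\kappa(z)A_\nu(\sigma(z))$ and $w^{(O)}_\nu=[\mathbf n_\nu]_{z_O}/\sqrt{\kappa(z_O)}$, the orbit response scalar is $\varphi_O(\gamma)=\sum_\nu f_\nu(\gamma)w^{(O)}_\nu$. For functions $\varphi,s$ of $\gamma$, $\mathcal W[\varphi,s]=\varphi's-\varphi s'$ (derivatives in $\gamma$). Vertex condition (V): there is $\varepsilon\in\{\pm1\}$ such that for every orbit $O$ and both of its sites $z\in O$, $\varepsilon\,\mathcal W[\varphi_O,s(z;\cdot)](\gamma)>0$ for all $\gamma\in(0,1)$. *)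

theory Defs
  imports "HOL-Analysis.Analysis"
begin

text \<open>The set \<open>Z\<close> of sites is the universe of a finite type \<open>'n\<close> and the index set of \<open>\<nu>\<close> that of a
  finite type \<open>'k\<close>; thus \<open>m = CARD('n)\<close> and \<open>N = CARD('k)\<close>. The matrices \<open>(A\<^sub>\<nu>(z))\<close> and
  \<open>(B\<^sub>\<nu>(z))\<close> are \<open>A $ \<nu> $ z\<close> and \<open>B $ \<nu> $ z\<close>, and the vertex \<open>e\<^sub>z\<close> is \<open>axis z 1\<close>.\<close>

definition simplex_on_sites :: "(real ^ 'n) set" where
  "simplex_on_sites = {\<pi>. (\<forall>z. 0 \<le> \<pi> $ z) \<and> (\<Sum>z\<in>UNIV. \<pi> $ z) = 1}"

text \<open>Class \<open>C\<^sup>n\<close> on an open subset of a finite-dimensional space, through iterated directional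
  derivatives.\<close>

primrec Cn_on_open :: "nat \<Rightarrow> ('a::euclidean_space \<Rightarrow> real) \<Rightarrow> 'a set \<Rightarrow> bool" where
  "Cn_on_open 0 g U \<longleftrightarrow> continuous_on U g"
| "Cn_on_open (Suc n) g U \<longleftrightarrow>
     (\<forall>x\<in>U. g differentiable (at x)) \<and>
     (\<forall>v. Cn_on_open n (\<lambda>x. frechet_derivative g (at x) v) U)"

text \<open>On an arbitrary set (such as the simplex, which has empty interior) a function is of class
  \<open>C\<^sup>k\<close> if near each point of the set it is the restriction of a \<open>C\<^sup>k\<close> function on an open set.\<close>

definition Ck_on :: "enat \<Rightarrow> ('a::euclidean_space \<Rightarrow> real) \<Rightarrow> 'a set \<Rightarrow> bool" where
  "Ck_on k g S \<longleftrightarrow>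
     (\<forall>x\<in>S. \<exists>U h. open U \<and> x \<in> U \<and> (\<forall>n. enat n \<le> k \<longrightarrow> Cn_on_open n h U) \<and>
                    (\<forall>y\<in>S \<inter> U. h y = g y))"

definition real_analytic_on :: "(real \<Rightarrow> real) \<Rightarrow> real set \<Rightarrow> bool" where
  "real_analytic_on g S \<longleftrightarrow> (\<forall>x\<in>S. \<exists>F. (\<lambda>h. g (x + h)) has_fps_expansion F)"

definition lin_indep_functions_on :: "('k::finite \<Rightarrow> real \<Rightarrow> real) \<Rightarrow> real set \<Rightarrow> bool" where
  "lin_indep_functions_on f S \<longleftrightarrow>
     (\<forall>c. (\<forall>\<gamma>\<in>S. (\<Sum>\<nu>\<in>UNIV. c \<nu> * f \<nu> \<gamma>) = 0) \<longrightarrow> (\<forall>\<nu>. c \<nu> = 0))"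

definition u_fun :: "('k::finite \<Rightarrow> real \<Rightarrow> real) \<Rightarrow> real ^ 'n ^ 'k \<Rightarrow> 'n \<Rightarrow> real \<Rightarrow> real" where
  "u_fun f A z \<gamma> = (\<Sum>\<nu>\<in>UNIV. f \<nu> \<gamma> * A $ \<nu> $ z)"

definition s_fun ::
  "('k::finite \<Rightarrow> real \<Rightarrow> real) \<Rightarrow> real ^ 'n ^ 'k \<Rightarrow> real ^ 'n ^ 'k \<Rightarrow> 'n \<Rightarrow> real \<Rightarrow> real" where
  "s_fun f A B z \<gamma> = (\<Sum>\<nu>\<in>UNIV. f \<nu> \<gamma> * (A $ \<nu> $ z + B $ \<nu> $ z))"

text \<open>A spectral duality structure together with its spectral representation. Values of \<open>C\<close>
  outside \<open>simplex_on_sites \<times> {0<..<1}\<close> are unconstrained.\<close>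

locale spectral_duality =
  fixes C :: "real ^ 'n \<Rightarrow> real \<Rightarrow> real"
    and f :: "'k::finite \<Rightarrow> real \<Rightarrow> real"
    and A B :: "real ^ 'n ^ 'k"
    and \<sigma> :: "'n \<Rightarrow> 'n"
    and \<kappa> :: "'n \<Rightarrow> real"
    and K :: real
  assumes two_sites: "2 \<le> CARD('n)"
    and smooth: "Ck_on \<infinity> (\<lambda>(\<pi>, \<gamma>). C \<pi> \<gamma>) (simplex_on_sites \<times> {0<..<1})"
    and S1_C1: "\<And>\<gamma>. \<gamma> \<in> {0<..<1} \<Longrightarrow> Ck_on 1 (\<lambda>\<pi>. C \<pi> \<gamma>) (rel_interior simplex_on_sites)"
    and S1_continuous: "\<And>\<gamma>. \<gamma> \<in> {0<..<1} \<Longrightarrow> continuous_on simplex_on_sites (\<lambda>\<pi>. C \<pi> \<gamma>)"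
    and S2_C: "\<And>\<pi> \<gamma>. \<pi> \<in> simplex_on_sites \<Longrightarrow> \<gamma> \<in> {0<..<1} \<Longrightarrow>
        C \<pi> \<gamma> = (\<Sum>z\<in>UNIV. \<pi> $ z * u_fun f A z \<gamma>) / (\<Sum>z\<in>UNIV. \<pi> $ z * s_fun f A B z \<gamma>)"
    and S2_pos: "\<And>\<pi> \<gamma>. \<pi> \<in> simplex_on_sites \<Longrightarrow> \<gamma> \<in> {0<..<1} \<Longrightarrow>
        0 < (\<Sum>z\<in>UNIV. \<pi> $ z * s_fun f A B z \<gamma>)"
    and S2_analytic: "\<And>\<nu>. real_analytic_on (f \<nu>) {0<..<1}"
    and S2_indep: "lin_indep_functions_on f {0<..<1}"
    and S2_size: "CARD('n) \<le> CARD('k)"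
    and S2_rank: "rank A = CARD('n)"
    and S3_involution: "\<And>z. \<sigma> (\<sigma> z) = z"
    and S3_nontrivial: "\<exists>z. \<sigma> z \<noteq> z"
    and S3_weights: "\<And>z. 0 < \<kappa> z"
    and S3_B: "\<And>\<nu> z. B $ \<nu> $ z = \<kappa> z * A $ \<nu> $ (\<sigma> z)"
    and S4_pos: "0 < K"
    and S4: "\<And>z. \<kappa> z * \<kappa> (\<sigma> z) = K"

definition C_star :: "real \<Rightarrow> real" where
  "C_star K = 1 / (1 + sqrt K)"

definition orbits :: "('n \<Rightarrow> 'n) \<Rightarrow> 'n set set" where
  "orbits \<sigma> = {{z, \<sigma> z} | z. \<sigma> z \<noteq> z}"

text \<open>In the following, \<open>rep\<close> is the fixed choice \<open>\<O> \<mapsto> z\<^sub>\<O>\<close> of orbit representatives.\<close>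

definition orbit_director ::
  "('n \<Rightarrow> 'n) \<Rightarrow> ('n \<Rightarrow> real) \<Rightarrow> ('n set \<Rightarrow> 'n) \<Rightarrow> 'n set \<Rightarrow> real ^ 'n" where
  "orbit_director \<sigma> \<kappa> rep \<O> =
     (\<chi> z. if z = rep \<O> then sqrt (\<kappa> (rep \<O>))
           else if z = \<sigma> (rep \<O>) then - sqrt (\<kappa> (\<sigma> (rep \<O>)))
           else 0)"

definition n_vec ::
  "real ^ 'n ^ 'k \<Rightarrow> ('n \<Rightarrow> 'n) \<Rightarrow> ('n \<Rightarrow> real) \<Rightarrow> real \<Rightarrow> 'k \<Rightarrow> real ^ 'n" where
  "n_vec A \<sigma> \<kappa> K \<nu> = (\<chi> z. (1 - C_star K) * A $ \<nu> $ z - C_star K * \<kappa> z * A $ \<nu> $ (\<sigma> z))"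

definition orbit_weight ::
  "real ^ 'n ^ 'k \<Rightarrow> ('n \<Rightarrow> 'n) \<Rightarrow> ('n \<Rightarrow> real) \<Rightarrow> real \<Rightarrow> ('n set \<Rightarrow> 'n) \<Rightarrow> 'n set \<Rightarrow> 'k \<Rightarrow> real" where
  "orbit_weight A \<sigma> \<kappa> K rep \<O> \<nu> = n_vec A \<sigma> \<kappa> K \<nu> $ rep \<O> / sqrt (\<kappa> (rep \<O>))"

definition orbit_response ::
  "('k::finite \<Rightarrow> real \<Rightarrow> real) \<Rightarrow> real ^ 'n ^ 'k \<Rightarrow> ('n \<Rightarrow> 'n) \<Rightarrow> ('n \<Rightarrow> real) \<Rightarrow> real \<Rightarrow>
   ('n set \<Rightarrow> 'n) \<Rightarrow> 'n set \<Rightarrow> real \<Rightarrow> real" where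
  "orbit_response f A \<sigma> \<kappa> K rep \<O> \<gamma> = (\<Sum>\<nu>\<in>UNIV. f \<nu> \<gamma> * orbit_weight A \<sigma> \<kappa> K rep \<O> \<nu>)"

definition wronskian :: "(real \<Rightarrow> real) \<Rightarrow> (real \<Rightarrow> real) \<Rightarrow> real \<Rightarrow> real" where
  "wronskian \<phi> s \<gamma> = deriv \<phi> \<gamma> * s \<gamma> - \<phi> \<gamma> * deriv s \<gamma>"

definition vertex_condition ::
  "('k::finite \<Rightarrow> real \<Rightarrow> real) \<Rightarrow> real ^ 'n ^ 'k \<Rightarrow> real ^ 'n ^ 'k \<Rightarrow> ('n \<Rightarrow> 'n) \<Rightarrow> ('n \<Rightarrow> real) \<Rightarrow>
   real \<Rightarrow> ('n set \<Rightarrow> 'n) \<Rightarrow> real \<Rightarrow> bool" where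
  "vertex_condition f A B \<sigma> \<kappa> K rep \<epsilon> \<longleftrightarrow>
     \<epsilon> \<in> {1, -1} \<and>
     (\<forall>\<O>\<in>orbits \<sigma>. \<forall>z\<in>\<O>. \<forall>\<gamma>\<in>{0<..<1}.
        0 < \<epsilon> * wronskian (orbit_response f A \<sigma> \<kappa> K rep \<O>) (s_fun f A B z) \<gamma>)"

definition increasing_sites :: "(real ^ 'n \<Rightarrow> real \<Rightarrow> real) \<Rightarrow> 'n set" where
  "increasing_sites C = {z. strict_mono_on {0<..<1} (C (axis z 1))}"

definition decreasing_sites :: "(real ^ 'n \<Rightarrow> real \<Rightarrow> real) \<Rightarrow> 'n set" where
  "decreasing_sites C = {z. strict_antimono_on {0<..<1} (C (axis z 1))}"

end

theory Submission imports Defs begin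

text \<open>At a vertex, \<open>C(e\<^sub>z, \<gamma>) = u(z; \<gamma>) / s(z; \<gamma>)\<close> with \<open>s(z) = u(z) + \<kappa>(z) u(\<sigma>(z))\<close>. Since
  \<open>1 - C\<^sup>* = \<surd>K C\<^sup>*\<close> and \<open>\<kappa>(z) \<kappa>(\<sigma>(z)) = K\<close>, the quantity \<open>u(z) - C\<^sup>* s(z)\<close> vanishes at neutral
  sites, and both sites of an orbit \<open>O\<close> share one scalar: \<open>u(z) - C\<^sup>* s(z) = [d\<^sub>O]\<^sub>z \<phi>\<^sub>O\<close>. Hence
  \<open>C(e\<^sub>z, \<cdot>) = C\<^sup>* + [d\<^sub>O]\<^sub>z \<phi>\<^sub>O / s(z)\<close> has derivative \<open>[d\<^sub>O]\<^sub>z W[\<phi>\<^sub>O, s(z)] / s(z)\<^sup>2\<close>, whose sign is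
  \<open>\<epsilon> sgn [d\<^sub>O]\<^sub>z\<close>, and \<open>d\<^sub>O\<close> takes opposite signs at the two sites of \<open>O\<close>.\<close>

section \<open>Calculus on an open interval: analyticity, derivative signs and monotonicity\<close>

lemma real_analytic_on_imp_differentiable:
  assumes "real_analytic_on g S" and "x \<in> S"
  shows "g differentiable (at x)"
proof -
  obtain F where F: "(\<lambda>h. g (x + h)) has_fps_expansion F"
    using assms unfolding real_analytic_on_def by blast
  \<comment> \<open>The expansion has positive radius of convergence, so 0 lies inside its disc and
    the sum can be differentiated there; it agrees with the shifted function near 0, which carries
    the derivative over.\<close>
  have "(eval_fps F has_field_derivative eval_fps (fps_deriv F) 0) (at 0)"
    using F unfolding has_fps_expansion_def
    by (intro has_field_derivative_eval_fps) (simp flip: zero_ereal_def)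
  moreover have "eventually (\<lambda>h. eval_fps F h = g (x + h)) (nhds 0)"
    using F unfolding has_fps_expansion_def by blast
  ultimately have "((\<lambda>h. g (x + h)) has_field_derivative eval_fps (fps_deriv F) 0) (at 0)"
    by (metis DERIV_cong_ev)
  then have "(g has_field_derivative eval_fps (fps_deriv F) 0) (at x)"
    using DERIV_shift[of g _ 0 x] by (simp add: add.commute)
  then show ?thesis
    by (auto simp: real_differentiable_def)
qed

lemma deriv_pos_imp_strict_mono_on_interval:
  fixes g g' :: "real \<Rightarrow> real" and a b :: real
  assumes "\<And>x. x \<in> {a<..<b} \<Longrightarrow> (g has_real_derivative g' x) (at x)"
    and "\<And>x. x \<in> {a<..<b} \<Longrightarrow> 0 < g' x"
  shows "strict_mono_on {a<..<b} g"
proof (rule strict_mono_onI)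
  fix r s assume "r \<in> {a<..<b}" "s \<in> {a<..<b}" "r < s"
  \<comment> \<open>The closed interval from \<open>r\<close> to \<open>s\<close> stays inside the
    open one, so the derivative is available at its endpoints too.\<close>
  then have "\<exists>y. DERIV g x :> y \<and> 0 < y" if "r \<le> x" "x \<le> s" for x
    using assms[of x] that by auto
  then show "g r < g s"
    using DERIV_pos_imp_increasing \<open>r < s\<close> by blast
qed

lemma deriv_neg_imp_strict_antimono_on_interval:
  fixes g g' :: "real \<Rightarrow> real" and a b :: real
  assumes "\<And>x. x \<in> {a<..<b} \<Longrightarrow> (g has_real_derivative g' x) (at x)"
    and "\<And>x. x \<in> {a<..<b} \<Longrightarrow> g' x < 0"
  shows "strict_antimono_on {a<..<b} g"
proof (rule monotone_onI)
  fix r s assume "r \<in> {a<..<b}" "s \<in> {a<..<b}" "r < s"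
  then have "\<exists>y. DERIV g x :> y \<and> y < 0" if "r \<le> x" "x \<le> s" for x
    using assms[of x] that by auto
  then show "g s < g r"
    using DERIV_neg_imp_decreasing \<open>r < s\<close> by blast
qed

lemma not_strict_mono_antimono_on_interval:
  fixes g :: "real \<Rightarrow> real" and a b :: real
  assumes "a < b" and "strict_mono_on {a<..<b} g" and "strict_antimono_on {a<..<b} g"
  shows False
proof -
  obtain y where y: "a < y" "y < b" using dense[OF assms(1)] by blast
  obtain x where x: "a < x" "x < y" using dense[OF y(1)] by blast
  have xy: "x \<in> {a<..<b}" "y \<in> {a<..<b}" using x y by auto
  show False
    using strict_mono_onD[OF assms(2) xy x(2)] monotone_onD[OF assms(3) xy x(2)] by simp
qed

text \<open>Keeps neutral sites, whose vertex values are constant in \<gamma>, out of both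
  monotonicity classes.\<close>

lemma not_strict_mono_antimono_on_interval_const:
  fixes g :: "real \<Rightarrow> real" and a b :: real
  assumes "a < b" and "\<forall>x\<in>{a<..<b}. g x = c"
  shows "\<not> strict_mono_on {a<..<b} g" and "\<not> strict_antimono_on {a<..<b} g"
proof -
  obtain y where y: "a < y" "y < b" using dense[OF assms(1)] by blast
  obtain x where x: "a < x" "x < y" using dense[OF y(1)] by blast
  have xy: "x \<in> {a<..<b}" "y \<in> {a<..<b}" using x y by auto
  then have "g x = g y" using assms(2) by simp
  then show "\<not> strict_mono_on {a<..<b} g" "\<not> strict_antimono_on {a<..<b} g"
    using strict_mono_onD[of "{a<..<b}" g x y]
      monotone_onD[of "{a<..<b}" "(<)" "(>)" g x y] xy x(2) by auto
qed

section \<open>Values at the vertices and neutral sites\<close>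

lemma axis_in_simplex: "axis z 1 \<in> simplex_on_sites"
  by (simp add: simplex_on_sites_def axis_def)

lemma sum_axis_nth_mult:
  fixes g :: "'n::finite \<Rightarrow> real"
  shows "(\<Sum>y\<in>UNIV. axis z 1 $ y * g y) = g z"
proof -
  have "(\<Sum>y\<in>UNIV. axis z 1 $ y * g y) = (\<Sum>y\<in>UNIV. if y = z then g y else 0)"
    by (intro sum.cong) (auto simp: axis_def)
  then show ?thesis by simp
qed

context spectral_duality
begin

lemma C_vertex:
  assumes "\<gamma> \<in> {0<..<1}"
  shows "C (axis z 1) \<gamma> = u_fun f A z \<gamma> / s_fun f A B z \<gamma>"
  using S2_C[OF axis_in_simplex assms, of z] by (simp add: sum_axis_nth_mult)

lemma s_fun_pos:
  assumes "\<gamma> \<in> {0<..<1}"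
  shows "0 < s_fun f A B z \<gamma>"
  using S2_pos[OF axis_in_simplex assms, of z] by (simp add: sum_axis_nth_mult)

lemma s_fun_eq: "s_fun f A B z \<gamma> = u_fun f A z \<gamma> + \<kappa> z * u_fun f A (\<sigma> z) \<gamma>"
  by (simp add: s_fun_def u_fun_def S3_B algebra_simps sum.distrib sum_distrib_left)

lemma one_plus_sqrt_K_pos: "0 < 1 + sqrt K"
  using S4_pos by (simp add: add_pos_pos)

lemma C_star_complement: "1 - C_star K = sqrt K * C_star K"
  using one_plus_sqrt_K_pos by (simp add: C_star_def field_simps)

lemma neutral_vertex:
  assumes "\<sigma> z = z" and "\<gamma> \<in> {0<..<1}"
  shows "C (axis z 1) \<gamma> = C_star K"
proof -
  \<comment> \<open>At a fixed point of \<open>\<sigma>\<close> both weights in \<open>S4\<close>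
    coincide, and positivity selects the root \<open>\<kappa> z\<close>.\<close>
  have "K = (\<kappa> z)\<^sup>2" using S4[of z] assms(1) by (simp add: power2_eq_square)
  then have "sqrt K = \<kappa> z" using S3_weights[of z] by simp
  then have "s_fun f A B z \<gamma> = (1 + sqrt K) * u_fun f A z \<gamma>"
    by (simp add: s_fun_eq assms(1) algebra_simps)
  \<comment> \<open>Positivity of the denominator makes \<open>u\<close> nonzero, so it cancels from
    the quotient u / ((1 + \<open>sqrt K\<close>) u).\<close>
  moreover from this have "u_fun f A z \<gamma> \<noteq> 0" using s_fun_pos[OF assms(2), of z] by auto
  ultimately show ?thesis
    using one_plus_sqrt_K_pos by (simp add: C_vertex[OF assms(2)] C_star_def)
qed

section \<open>The scalar shared by the two sites of an orbit\<close>

text \<open>The factor \<open>sqrt (\<kappa> (rep \<O>))\<close> clears the normalisation of the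
  orbit weights, leaving the components of \<open>n_vec\<close> at the representative; their sum
  against the \<open>f \<nu>\<close> turns entries of \<open>A\<close> into values of
  \<open>u_fun\<close>.\<close>

lemma orbit_response_rep:
  "sqrt (\<kappa> (rep \<O>)) * orbit_response f A \<sigma> \<kappa> K rep \<O> \<gamma> =
     C_star K * (sqrt K * u_fun f A (rep \<O>) \<gamma> - \<kappa> (rep \<O>) * u_fun f A (\<sigma> (rep \<O>)) \<gamma>)"
proof -
  have "sqrt (\<kappa> (rep \<O>)) * orbit_weight A \<sigma> \<kappa> K rep \<O> \<nu> =
      C_star K * (sqrt K * A $ \<nu> $ rep \<O> - \<kappa> (rep \<O>) * A $ \<nu> $ \<sigma> (rep \<O>))" for \<nu>
  proof -
    have "sqrt (\<kappa> (rep \<O>)) * orbit_weight A \<sigma> \<kappa> K rep \<O> \<nu> = n_vec A \<sigma> \<kappa> K \<nu> $ rep \<O>"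
      using S3_weights[of "rep \<O>"] by (simp add: orbit_weight_def)
    then show ?thesis by (simp add: n_vec_def C_star_complement algebra_simps)
  qed
  then have "sqrt (\<kappa> (rep \<O>)) * (f \<nu> \<gamma> * orbit_weight A \<sigma> \<kappa> K rep \<O> \<nu>) =
      C_star K * (sqrt K * (f \<nu> \<gamma> * A $ \<nu> $ rep \<O>)
        - \<kappa> (rep \<O>) * (f \<nu> \<gamma> * A $ \<nu> $ \<sigma> (rep \<O>)))" for \<nu>
    by (metis (no_types, lifting) mult.left_commute right_diff_distrib)
  then show ?thesis
    by (simp add: orbit_response_def u_fun_def sum_distrib_left flip: sum_subtractf)
qed

text \<open>Write r for the representative and a, b for the square roots of the weights at r and
  \<open>\<sigma>\<close> r. By \<open>S4\<close>, \<open>sqrt K\<close> = ab. Up to the factor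
  \<open>C_star K\<close>, the left side is ab u(r) - a a u(\<open>\<sigma>\<close> r) = a (b u(r) -
  a u(\<open>\<sigma>\<close> r)) at r, and ab u(\<open>\<sigma>\<close> r) - b b u(r), that is -b
  times the same bracket, at \<open>\<sigma>\<close> r. The factors a and -b are the director
  entries.\<close>

lemma u_minus_C_star_s:
  assumes orb: "\<O> \<in> orbits \<sigma>" and rep: "rep \<O> \<in> \<O>" and z: "z \<in> \<O>"
  shows "u_fun f A z \<gamma> - C_star K * s_fun f A B z \<gamma> =
    orbit_director \<sigma> \<kappa> rep \<O> $ z * orbit_response f A \<sigma> \<kappa> K rep \<O> \<gamma>"
proof -
  let ?r = "rep \<O>" and ?\<phi> = "orbit_response f A \<sigma> \<kappa> K rep \<O> \<gamma>"
  let ?u = "\<lambda>z. u_fun f A z \<gamma>"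
  have ne: "\<sigma> ?r \<noteq> ?r" and cases: "z = ?r \<or> z = \<sigma> ?r"
    using orb rep z S3_involution by (auto simp: orbits_def)
  have lhs: "?u y - C_star K * s_fun f A B y \<gamma> =
      C_star K * (sqrt K * ?u y - \<kappa> y * ?u (\<sigma> y))" for y
  proof -
    have "?u y - C_star K * s_fun f A B y \<gamma> = (1 - C_star K) * ?u y - C_star K * \<kappa> y * ?u (\<sigma> y)"
      by (simp add: s_fun_eq algebra_simps)
    then show ?thesis by (simp add: C_star_complement algebra_simps)
  qed
  from cases show ?thesis
  proof
    assume "z = ?r"
    then show ?thesis by (simp add: lhs orbit_response_rep orbit_director_def)
  next
    assume zs: "z = \<sigma> ?r"
    define a b where "a = sqrt (\<kappa> ?r)" and "b = sqrt (\<kappa> (\<sigma> ?r))"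
    have a: "0 < a" and sq: "\<kappa> ?r = a * a" "\<kappa> (\<sigma> ?r) = b * b"
      using S3_weights by (auto simp: a_def b_def less_imp_le)
    have ab: "sqrt K = a * b" using S4[of ?r] by (metis a_def b_def real_sqrt_mult)
    \<comment> \<open>Isolates one factor \<open>a\<close> on each side so that cancelling it
      identifies the common bracket with the response scalar.\<close>
    have "a * ?\<phi> = a * (C_star K * (b * ?u ?r - a * ?u (\<sigma> ?r)))"
      using orbit_response_rep[of rep \<O> \<gamma>] unfolding a_def[symmetric] ab unfolding sq(1)
      by (simp only: algebra_simps)
    then have \<phi>: "?\<phi> = C_star K * (b * ?u ?r - a * ?u (\<sigma> ?r))"
      using a by simp
    have "C_star K * (sqrt K * ?u z - \<kappa> z * ?u (\<sigma> z)) =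
        C_star K * (a * b * ?u (\<sigma> ?r) - b * b * ?u ?r)"
      by (simp only: zs S3_involution ab sq(2))
    also have "\<dots> = - b * ?\<phi>" unfolding \<phi> by (simp add: algebra_simps)
    \<comment> \<open>Since \<open>\<sigma> ?r\<close> differs from \<open>?r\<close>, the director
      takes its second branch here, with entry \<open>- b\<close>.\<close>
    finally show ?thesis using ne by (simp add: lhs orbit_director_def zs b_def)
  qed
qed

section \<open>Derivatives of the vertex functions\<close>

lemma orbit_response_differentiable:
  assumes "\<gamma> \<in> {0<..<1}"
  shows "orbit_response f A \<sigma> \<kappa> K rep \<O> differentiable (at \<gamma>)"
  unfolding orbit_response_def
  by (intro differentiable_sum differentiable_mult finite_UNIV ballI
      real_analytic_on_imp_differentiable[OF S2_analytic assms]) auto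

lemma s_fun_differentiable:
  assumes "\<gamma> \<in> {0<..<1}"
  shows "s_fun f A B z differentiable (at \<gamma>)"
  unfolding s_fun_def
  by (intro differentiable_sum differentiable_mult finite_UNIV ballI
      real_analytic_on_imp_differentiable[OF S2_analytic assms]) auto

lemma C_vertex_has_derivative:
  assumes orb: "\<O> \<in> orbits \<sigma>" "rep \<O> \<in> \<O>" "z \<in> \<O>" and \<gamma>: "\<gamma> \<in> {0<..<1}"
  shows "(C (axis z 1) has_real_derivative
    orbit_director \<sigma> \<kappa> rep \<O> $ z *
      wronskian (orbit_response f A \<sigma> \<kappa> K rep \<O>) (s_fun f A B z) \<gamma> / (s_fun f A B z \<gamma>)\<^sup>2) (at \<gamma>)"
proof -
  let ?\<phi> = "orbit_response f A \<sigma> \<kappa> K rep \<O>" and ?s = "s_fun f A B z"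
  let ?d = "orbit_director \<sigma> \<kappa> rep \<O> $ z"
  have \<phi>': "(?\<phi> has_real_derivative deriv ?\<phi> \<gamma>) (at \<gamma>)"
    and s': "(?s has_real_derivative deriv ?s \<gamma>) (at \<gamma>)"
    using orbit_response_differentiable[OF \<gamma>] s_fun_differentiable[OF \<gamma>]
    by (auto simp: DERIV_deriv_iff_real_differentiable)
  have "((\<lambda>t. C_star K + ?d * (?\<phi> t / ?s t)) has_real_derivative
      ?d * wronskian ?\<phi> ?s \<gamma> / (?s \<gamma>)\<^sup>2) (at \<gamma>)"
    using s_fun_pos[OF \<gamma>, of z]
    by (auto intro!: derivative_eq_intros \<phi>' s' simp: wronskian_def power2_eq_square algebra_simps)
  \<comment> \<open>The two functions agree only where the representation of \<open>C\<close> holds,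
    so the derivative is transferred within the open interval around \<gamma>.\<close>
  moreover have "C_star K + ?d * (?\<phi> t / ?s t) = C (axis z 1) t" if "t \<in> {0<..<1}" for t
    using u_minus_C_star_s[where rep = rep, OF orb, of t] s_fun_pos[OF that, of z]
    by (simp add: C_vertex[OF that] field_simps)
  ultimately show ?thesis
    using has_field_derivative_transform_within_open[OF _ open_greaterThanLessThan \<gamma>] by blast
qed

lemma sgn_deriv_C_vertex:
  assumes V: "vertex_condition f A B \<sigma> \<kappa> K rep \<epsilon>"
    and orb: "\<O> \<in> orbits \<sigma>" "rep \<O> \<in> \<O>" "z \<in> \<O>" and \<gamma>: "\<gamma> \<in> {0<..<1}"
  shows "sgn (deriv (C (axis z 1)) \<gamma>) = \<epsilon> * sgn (orbit_director \<sigma> \<kappa> rep \<O> $ z)"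
proof -
  let ?W = "wronskian (orbit_response f A \<sigma> \<kappa> K rep \<O>) (s_fun f A B z) \<gamma>"
  have "\<epsilon> \<in> {1, -1}" "0 < \<epsilon> * ?W"
    using V orb \<gamma> unfolding vertex_condition_def by blast+
  \<comment> \<open>A product with \<epsilon> = 1 or \<epsilon> = -1 is positive only if the other
    factor has the sign \<epsilon>.\<close>
  then have "sgn ?W = \<epsilon>"
    by auto
  moreover have "sgn ((s_fun f A B z \<gamma>)\<^sup>2) = 1"
    using s_fun_pos[OF \<gamma>, of z] by simp
  ultimately show ?thesis
    using DERIV_imp_deriv[OF C_vertex_has_derivative[where rep = rep, OF orb \<gamma>]]
    by (simp add: sgn_mult)
qed

section \<open>Opposite responses within an orbit and the exchange of classes\<close>

lemma sgn_orbit_director: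
  assumes "\<O> \<in> orbits \<sigma>" "rep \<O> \<in> \<O>" "z \<in> \<O>"
  shows "sgn (orbit_director \<sigma> \<kappa> rep \<O> $ z) = (if z = rep \<O> then 1 else -1)"
    and "\<sigma> z \<in> \<O>" and "z = rep \<O> \<longleftrightarrow> \<sigma> z \<noteq> rep \<O>"
proof -
  obtain x where x: "\<O> = {x, \<sigma> x}" "\<sigma> x \<noteq> x"
    using assms(1) unfolding orbits_def by blast
  show "\<sigma> z \<in> \<O>"
    using assms(3) S3_involution[of x] by (auto simp: x)
  \<comment> \<open>The orbit has two distinct elements swapped by \<open>\<sigma>\<close>, so
    exactly one of \<open>z\<close> and \<open>\<sigma> z\<close> is the representative.\<close>
  show iff: "z = rep \<O> \<longleftrightarrow> \<sigma> z \<noteq> rep \<O>"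
    using assms(2,3) x S3_involution[of x] by auto
  have "z = \<sigma> (rep \<O>)" if "z \<noteq> rep \<O>"
    using iff S3_involution[of z] that by auto
  then show "sgn (orbit_director \<sigma> \<kappa> rep \<O> $ z) = (if z = rep \<O> then 1 else -1)"
    using S3_weights[of "rep \<O>"] S3_weights[of "\<sigma> (rep \<O>)"]
    by (cases "z = rep \<O>") (simp_all add: orbit_director_def sgn_minus)
qed

text \<open>The derivative sign \<open>\<epsilon> * sgn (orbit_director \<sigma> \<kappa> rep \<O> $
  y)\<close> does not depend on \<gamma>, so it settles monotonicity on the whole interval; it flips
  between \<open>z\<close> and \<open>\<sigma> z\<close>.\<close>

lemma orbit_vertices_opposite:
  assumes V: "vertex_condition f A B \<sigma> \<kappa> K rep \<epsilon>"
    and orb: "\<O> \<in> orbits \<sigma>" "rep \<O> \<in> \<O>" "z \<in> \<O>"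
  shows "strict_mono_on {0<..<1} (C (axis z 1)) \<and> strict_antimono_on {0<..<1} (C (axis (\<sigma> z) 1)) \<or>
    strict_antimono_on {0<..<1} (C (axis z 1)) \<and> strict_mono_on {0<..<1} (C (axis (\<sigma> z) 1))"
proof -
  have \<epsilon>: "\<epsilon> = 1 \<or> \<epsilon> = -1" using V by (simp add: vertex_condition_def)
  have D: "(C (axis y 1) has_real_derivative deriv (C (axis y 1)) \<gamma>) (at \<gamma>)"
    if "y \<in> \<O>" "\<gamma> \<in> {0<..<1}" for y \<gamma>
    using C_vertex_has_derivative[where rep = rep, OF orb(1,2) that] DERIV_imp_deriv by metis
  note dz = sgn_deriv_C_vertex[OF V orb(1,2)]
  have mono: "strict_mono_on {0<..<1} (C (axis y 1))"
    if "y \<in> \<O>" "\<epsilon> * sgn (orbit_director \<sigma> \<kappa> rep \<O> $ y) = 1" for y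
  proof (rule deriv_pos_imp_strict_mono_on_interval[OF D[OF that(1)]])
    show "0 < deriv (C (axis y 1)) \<gamma>" if "\<gamma> \<in> {0<..<1}" for \<gamma>
      using dz[OF \<open>y \<in> \<O>\<close> that] \<open>_ = 1\<close> by (simp add: sgn_1_pos)
  qed
  have anti: "strict_antimono_on {0<..<1} (C (axis y 1))"
    if "y \<in> \<O>" "\<epsilon> * sgn (orbit_director \<sigma> \<kappa> rep \<O> $ y) = -1" for y
  proof (rule deriv_neg_imp_strict_antimono_on_interval[OF D[OF that(1)]])
    show "deriv (C (axis y 1)) \<gamma> < 0" if "\<gamma> \<in> {0<..<1}" for \<gamma>
      using dz[OF \<open>y \<in> \<O>\<close> that] \<open>_ = - 1\<close> by (simp add: sgn_1_neg)
  qed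
  note sd = sgn_orbit_director[where rep = rep, OF orb(1,2)]
  show ?thesis
    using \<epsilon> sd(1)[OF orb(3)] sd(1)[OF sd(2)[OF orb(3)]] sd(2,3)[OF orb(3)]
      mono[OF orb(3)] anti[OF orb(3)] mono[OF sd(2)[OF orb(3)]] anti[OF sd(2)[OF orb(3)]]
    by (cases "z = rep \<O>") auto
qed

lemma increasing_iff_decreasing_partner:
  assumes V: "vertex_condition f A B \<sigma> \<kappa> K rep \<epsilon>"
    and rep: "\<forall>\<O>\<in>orbits \<sigma>. rep \<O> \<in> \<O>"
  shows "z \<in> increasing_sites C \<longleftrightarrow> \<sigma> z \<in> decreasing_sites C"
proof (cases "\<sigma> z = z")
  case True
  then have "\<forall>\<gamma>\<in>{0<..<1}. C (axis z 1) \<gamma> = C_star K"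
    using neutral_vertex by blast
  \<comment> \<open>Here \<open>\<sigma> z\<close> is \<open>z\<close> itself, and the equivalence
    holds because both sides are false.\<close>
  from not_strict_mono_antimono_on_interval_const[OF zero_less_one this] show ?thesis
    by (simp add: increasing_sites_def decreasing_sites_def True)
next
  case False
  then have orb: "{z, \<sigma> z} \<in> orbits \<sigma>" by (auto simp: orbits_def)
  then have "rep {z, \<sigma> z} \<in> {z, \<sigma> z}" using rep by blast
  \<comment> \<open>Of the two opposite patterns, either membership selects the same one, because no
    function on the interval is both strictly increasing and strictly decreasing.\<close>
  from orbit_vertices_opposite[OF V orb this insertI1] show ?thesis
    using not_strict_mono_antimono_on_interval[OF zero_less_one, of "C (axis z 1)"]
      not_strict_mono_antimono_on_interval[OF zero_less_one, of "C (axis (\<sigma> z) 1)"]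
    unfolding increasing_sites_def decreasing_sites_def mem_Collect_eq by blast
qed

end

theorem theorem6p6:
  fixes C :: "real ^ 'n \<Rightarrow> real \<Rightarrow> real"
    and f :: "'k::finite \<Rightarrow> real \<Rightarrow> real"
    and A B :: "real ^ 'n ^ 'k"
    and \<sigma> :: "'n \<Rightarrow> 'n"
    and \<kappa> :: "'n \<Rightarrow> real"
    and K :: real
    and rep :: "'n set \<Rightarrow> 'n"
  assumes duality: "spectral_duality C f A B \<sigma> \<kappa> K"
    and rep: "\<forall>\<O>\<in>orbits \<sigma>. rep \<O> \<in> \<O>"
  shows
    "(\<forall>z0. \<sigma> z0 = z0 \<longrightarrow> (\<forall>\<gamma>\<in>{0<..<1}. C (axis z0 1) \<gamma> = C_star K)) \<and>
     (\<forall>\<epsilon>. vertex_condition f A B \<sigma> \<kappa> K rep \<epsilon> \<longrightarrow>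
        (\<forall>\<O>\<in>orbits \<sigma>. \<forall>z\<in>\<O>.
           (strict_mono_on {0<..<1} (C (axis z 1)) \<or> strict_antimono_on {0<..<1} (C (axis z 1))) \<and>
           (\<forall>\<gamma>\<in>{0<..<1}. C (axis z 1) differentiable (at \<gamma>) \<and>
              sgn (deriv (C (axis z 1)) \<gamma>) = \<epsilon> * sgn (orbit_director \<sigma> \<kappa> rep \<O> $ z))) \<and>
        (\<forall>\<O>\<in>orbits \<sigma>. \<forall>z\<in>\<O>.
           (\<forall>\<gamma>\<in>{0<..<1}. sgn (deriv (C (axis z 1)) \<gamma>) = - sgn (deriv (C (axis (\<sigma> z) 1)) \<gamma>)) \<and>
           (strict_mono_on {0<..<1} (C (axis z 1)) \<and>
              strict_antimono_on {0<..<1} (C (axis (\<sigma> z) 1)) \<or>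
            strict_antimono_on {0<..<1} (C (axis z 1)) \<and>
              strict_mono_on {0<..<1} (C (axis (\<sigma> z) 1)))) \<and>
        \<sigma> ` increasing_sites C = decreasing_sites C \<and>
        \<sigma> ` decreasing_sites C = increasing_sites C)"
proof -
  interpret spectral_duality C f A B \<sigma> \<kappa> K by (rule duality)
  show ?thesis
  proof (intro conjI allI impI ballI)
    fix z0 \<gamma> assume "\<sigma> z0 = z0" "\<gamma> \<in> {0<..<1::real}"
    then show "C (axis z0 1) \<gamma> = C_star K" by (rule neutral_vertex)
  next
    fix \<epsilon> \<O> z assume V: "vertex_condition f A B \<sigma> \<kappa> K rep \<epsilon>"
      and "\<O> \<in> orbits \<sigma>" and "z \<in> \<O>"
    then have orb: "\<O> \<in> orbits \<sigma>" "rep \<O> \<in> \<O>" "z \<in> \<O>" using rep by auto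
    note opp = orbit_vertices_opposite[OF V orb]
    show "strict_mono_on {0<..<1} (C (axis z 1)) \<or> strict_antimono_on {0<..<1} (C (axis z 1))"
      using opp by blast
    show "strict_mono_on {0<..<1} (C (axis z 1)) \<and>
        strict_antimono_on {0<..<1} (C (axis (\<sigma> z) 1)) \<or>
      strict_antimono_on {0<..<1} (C (axis z 1)) \<and>
        strict_mono_on {0<..<1} (C (axis (\<sigma> z) 1))"
      by (rule opp)
    fix \<gamma> :: real assume \<gamma>: "\<gamma> \<in> {0<..<1}"
    show "C (axis z 1) differentiable (at \<gamma>)"
      using C_vertex_has_derivative[where rep = rep, OF orb \<gamma>] real_differentiable_def by blast
    note sd = sgn_orbit_director[where rep = rep, OF orb(1,2)]
    note dz = sgn_deriv_C_vertex[OF V orb(1,2) _ \<gamma>]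
    show "sgn (deriv (C (axis z 1)) \<gamma>) = \<epsilon> * sgn (orbit_director \<sigma> \<kappa> rep \<O> $ z)"
      by (rule dz[OF orb(3)])
    show "sgn (deriv (C (axis z 1)) \<gamma>) = - sgn (deriv (C (axis (\<sigma> z) 1)) \<gamma>)"
      using sd(3)[OF orb(3)] sd(2)[OF orb(3)] orb(3) by (simp add: dz sd(1))
  next
    fix \<epsilon> assume "vertex_condition f A B \<sigma> \<kappa> K rep \<epsilon>"
    note swap = increasing_iff_decreasing_partner[OF this rep]
    have swap': "z \<in> decreasing_sites C \<longleftrightarrow> \<sigma> z \<in> increasing_sites C" for z
      using swap[of "\<sigma> z"] by (simp add: S3_involution)
    \<comment> \<open>For an involution the image of a set is its preimage, which reduces both set
      equations to the pointwise equivalences.\<close>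
    have image_iff_partner: "z \<in> \<sigma> ` X \<longleftrightarrow> \<sigma> z \<in> X" for z X
      by (metis S3_involution image_iff)
    show "\<sigma> ` increasing_sites C = decreasing_sites C"
      by (rule set_eqI) (simp only: image_iff_partner swap')
    show "\<sigma> ` decreasing_sites C = increasing_sites C"
      by (rule set_eqI) (simp only: image_iff_partner swap)
  qed
qed

end
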